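(* Let $t:\mathbb{N}\to\mathbb{N}$ be any monotone increasing function with $t(n)\le n/2$. Then \[BQC(COUNT^{t(n)}_n)\ge\Omega\!\left(\frac{t(n)}{\log t(n)}+\log n\right).\]
   Context: For $x,y\in\{0,1\}^n$, $COUNT^t_n(x,y)=1$ iff $\sum_{i=1}^n(x_i\wedge y_i)=t$. $\log$ is base 2. Quantum communication model (Yao, no prior entanglement): Alice receives $x$, Bob $y$; each holds private qubits initialized to the input and $|0\rangle$; in each round one player applies a unitary to his qubits and sends one qubit; at the end a qubit is measured giving the output; cost is the number of qubits exchanged. $BQC(f)$ is the minimum cost of a protocol computing $f$ with error probability at most $1/3$ on every input. *)

theory Defs
  imports Complex_Main "HOL-Library.Landau_Symbols"
begin

text \<open>Computational basis states of an m-qubit system: bit assignments to qubits 0..m-1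
  (all other positions False).  Bit vectors x in {0,1}^n are represented the same way.\<close>
definition basis :: "nat \<Rightarrow> (nat \<Rightarrow> bool) set" where
  "basis m = {b. \<forall>i\<ge>m. \<not> b i}"

text \<open>An operator on the m-qubit space, given by its matrix in the computational basis.\<close>
type_synonym qop = "(nat \<Rightarrow> bool) \<Rightarrow> (nat \<Rightarrow> bool) \<Rightarrow> complex"

definition unitary_op :: "nat \<Rightarrow> qop \<Rightarrow> bool" where
  "unitary_op m U \<longleftrightarrow> (\<forall>b\<in>basis m. \<forall>c\<in>basis m.
     (\<Sum>d\<in>basis m. cnj (U d b) * U d c) = (if b = c then 1 else 0))"

definition restr :: "nat set \<Rightarrow> (nat \<Rightarrow> bool) \<Rightarrow> (nat \<Rightarrow> bool)" where
  "restr S b = (\<lambda>i. if i \<in> S then b i else False)"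

text \<open>U acts only on the qubits in S, i.e. U = V \<otimes> Id.\<close>
definition local_op :: "nat \<Rightarrow> nat set \<Rightarrow> qop \<Rightarrow> bool" where
  "local_op m S U \<longleftrightarrow> (\<exists>V. \<forall>b\<in>basis m. \<forall>c\<in>basis m.
     U b c = (if (\<forall>i. i \<notin> S \<longrightarrow> b i = c i) then V (restr S b) (restr S c) else 0))"

text \<open>A quantum two-party protocol (Yao model, no prior entanglement).
  Qubits 0..nq-1; owner True = Alice, False = Bob.  In round k the player
  \<open>player k\<close> applies the unitary \<open>gate k\<close> to the qubits he currently owns and then
  sends qubit \<open>sent k\<close> to the other player.  At the end qubit \<open>outq\<close> is measured.\<close>
record qprot =
  nq :: nat
  rounds :: nat
  owner0 :: "nat \<Rightarrow> bool"
  player :: "nat \<Rightarrow> bool"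
  sent :: "nat \<Rightarrow> nat"
  gate :: "nat \<Rightarrow> qop"
  outq :: nat

primrec owner :: "qprot \<Rightarrow> nat \<Rightarrow> nat \<Rightarrow> bool" where
  "owner P 0 = owner0 P"
| "owner P (Suc k) = (owner P k)(sent P k := \<not> player P k)"

definition init_basis :: "nat \<Rightarrow> (nat \<Rightarrow> bool) \<Rightarrow> (nat \<Rightarrow> bool) \<Rightarrow> (nat \<Rightarrow> bool)" where
  "init_basis n x y = (\<lambda>i. if i < n then x i else if i < 2 * n then y (i - n) else False)"

primrec qstate :: "qprot \<Rightarrow> nat \<Rightarrow> (nat \<Rightarrow> bool) \<Rightarrow> (nat \<Rightarrow> bool) \<Rightarrow> nat \<Rightarrow> (nat \<Rightarrow> bool) \<Rightarrow> complex" where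
  "qstate P n x y 0 = (\<lambda>b. if b = init_basis n x y then 1 else 0)"
| "qstate P n x y (Suc k) = (\<lambda>b. \<Sum>c\<in>basis (nq P). gate P k b c * qstate P n x y k c)"

definition valid_prot :: "nat \<Rightarrow> qprot \<Rightarrow> bool" where
  "valid_prot n P \<longleftrightarrow> 2 * n \<le> nq P \<and> outq P < nq P
     \<and> (\<forall>i<n. owner0 P i) \<and> (\<forall>i. n \<le> i \<and> i < 2 * n \<longrightarrow> \<not> owner0 P i)
     \<and> (\<forall>k<rounds P. sent P k < nq P \<and> owner P k (sent P k) = player P k
          \<and> unitary_op (nq P) (gate P k)
          \<and> local_op (nq P) {i. i < nq P \<and> owner P k i = player P k} (gate P k))"

definition accept_prob :: "nat \<Rightarrow> qprot \<Rightarrow> (nat \<Rightarrow> bool) \<Rightarrow> (nat \<Rightarrow> bool) \<Rightarrow> real" where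
  "accept_prob n P x y =
     (\<Sum>b\<in>{b\<in>basis (nq P). b (outq P)}. (cmod (qstate P n x y (rounds P) b))\<^sup>2)"

definition computes :: "nat \<Rightarrow> ((nat \<Rightarrow> bool) \<Rightarrow> (nat \<Rightarrow> bool) \<Rightarrow> bool) \<Rightarrow> qprot \<Rightarrow> bool" where
  "computes n f P \<longleftrightarrow> valid_prot n P \<and>
     (\<forall>x\<in>basis n. \<forall>y\<in>basis n.
        (f x y \<longrightarrow> accept_prob n P x y \<ge> 2/3) \<and> (\<not> f x y \<longrightarrow> accept_prob n P x y \<le> 1/3))"

definition BQC :: "nat \<Rightarrow> ((nat \<Rightarrow> bool) \<Rightarrow> (nat \<Rightarrow> bool) \<Rightarrow> bool) \<Rightarrow> nat" where
  "BQC n f = (LEAST r. \<exists>P. computes n f P \<and> rounds P = r)"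

definition COUNT :: "nat \<Rightarrow> nat \<Rightarrow> (nat \<Rightarrow> bool) \<Rightarrow> (nat \<Rightarrow> bool) \<Rightarrow> bool" where
  "COUNT n t x y \<longleftrightarrow> card {i. i < n \<and> x i \<and> y i} = t"

end

theory Submission
  imports Defs "HOL-Analysis.Convex"
begin

text \<open>
  A protocol exchanging \<open>r\<close> qubits leaves the final state as a sum of \<open>2^r\<close> products of a vector
  depending on \<open>x\<close> and a vector depending on \<open>y\<close>, all of norm at most one; hence the matrix of
  acceptance probabilities is a sum of \<open>4^r\<close> products \<open>a(x) b(y)\<close> of functions bounded by one.
  Lindsey's lemma bounds the correlation of each product with the inner product sign
  \<open>(-1)^|x \<and> y|\<close>, and entrywise powers keep this form with \<open>r\<close> replaced by \<open>d r\<close>.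

  For \<open>\<Omega>(t / log t)\<close>, restrict to \<open>t\<close> free coordinates. Some overlap \<open>k \<le> t\<close> is taken by a fraction
  of at least \<open>1 / (t + 1)\<close> of all pairs, and \<open>t - k\<close> further common ones make exactly these pairs
  the accepted ones. The \<open>d\<close>-th entrywise power with \<open>d = O(log t)\<close> is concentrated on them, where
  the sign is constant, so it correlates with the sign far better than a few products can.
  For \<open>\<Omega>(log n)\<close>, restrict Bob to one free coordinate, which yields the index function.
\<close>

subsection \<open>Acceptance probabilities as short sums of products\<close>

definition subcube :: "nat set \<Rightarrow> (nat \<Rightarrow> bool) set" where
  "subcube S = {b. \<forall>i. i \<notin> S \<longrightarrow> \<not> b i}"

lemma basis_eq_subcube: "basis m = subcube {..<m}"
  by (auto simp: basis_def subcube_def)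

lemma bij_betw_subcube: "bij_betw (\<lambda>A i. i \<in> A) (Pow S) (subcube S)"
  by (rule bij_betwI[where g = "\<lambda>b. {i. b i}"]) (auto simp: subcube_def)

lemma finite_subcube: "finite S \<Longrightarrow> finite (subcube S)"
  using bij_betw_finite[OF bij_betw_subcube] by blast

lemma finite_basis: "finite (basis m)"
  by (simp add: basis_eq_subcube finite_subcube)

lemma card_basis: "card (basis m) = 2 ^ m"
  using bij_betw_same_card[OF bij_betw_subcube[of "{..<m}"]]
  by (simp add: basis_eq_subcube card_Pow)

lemma restr_in_subcube: "restr S b \<in> subcube S"
  by (simp add: restr_def subcube_def)

lemma sum_basis_split:
  fixes f :: "(nat \<Rightarrow> bool) \<Rightarrow> (nat \<Rightarrow> bool) \<Rightarrow> 'a::comm_monoid_add"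
  assumes ST: "S \<union> T = {..<m}" "S \<inter> T = {}"
  shows "(\<Sum>b\<in>basis m. f (restr S b) (restr T b)) = (\<Sum>s\<in>subcube S. \<Sum>t\<in>subcube T. f s t)"
proof -
  have "(\<Sum>b\<in>basis m. f (restr S b) (restr T b)) = (\<Sum>p\<in>subcube S \<times> subcube T. f (fst p) (snd p))"
  proof (rule sum.reindex_bij_witness[where i = "\<lambda>p i. fst p i \<or> snd p i" and j = "\<lambda>b. (restr S b, restr T b)"])
    fix b assume "b \<in> basis m"
    then have *: "b i \<Longrightarrow> i \<in> S \<union> T" for i
      unfolding ST(1) by (auto simp: basis_def not_le[symmetric])
    show "(\<lambda>i. fst (restr S b, restr T b) i \<or> snd (restr S b, restr T b) i) = b"
      using * by (fastforce simp: restr_def fun_eq_iff)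
  next
    fix p assume "p \<in> subcube S \<times> subcube T"
    then have p: "fst p i \<Longrightarrow> i \<in> S" "snd p i \<Longrightarrow> i \<in> T" for i
      by (auto simp: subcube_def)
    have "S \<subseteq> {..<m}" "T \<subseteq> {..<m}" using ST by auto
    then show "(\<lambda>i. fst p i \<or> snd p i) \<in> basis m"
      using p by (fastforce simp: basis_def)
    show "(restr S (\<lambda>i. fst p i \<or> snd p i), restr T (\<lambda>i. fst p i \<or> snd p i)) = p"
      using p ST(2) by (fastforce simp: restr_def prod_eq_iff fun_eq_iff)
  qed (auto simp: restr_in_subcube)
  then show ?thesis by (simp add: sum.cartesian_product split_def)
qed

definition factorised ::
  "nat set \<Rightarrow> nat set \<Rightarrow> 'x set \<Rightarrow> 'y set \<Rightarrow> nat \<Rightarrow> ('x \<Rightarrow> 'y \<Rightarrow> (nat \<Rightarrow> bool) \<Rightarrow> complex) \<Rightarrow> bool" where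
  "factorised S T X Y N \<psi> \<longleftrightarrow> (\<exists>A B.
     (\<forall>i<N. \<forall>x\<in>X. (\<Sum>c\<in>subcube S. (cmod (A i x c))\<^sup>2) \<le> 1) \<and>
     (\<forall>i<N. \<forall>y\<in>Y. (\<Sum>c\<in>subcube T. (cmod (B i y c))\<^sup>2) \<le> 1) \<and>
     (\<forall>x\<in>X. \<forall>y\<in>Y. \<forall>b\<in>subcube (S \<union> T).
        \<psi> x y b = (\<Sum>i<N. A i x (restr S b) * B i y (restr T b))))"

lemma factorisedE:
  assumes "factorised S T X Y N \<psi>"
  obtains A B where
    "\<And>i x. i < N \<Longrightarrow> x \<in> X \<Longrightarrow> (\<Sum>c\<in>subcube S. (cmod (A i x c))\<^sup>2) \<le> 1"
    "\<And>i y. i < N \<Longrightarrow> y \<in> Y \<Longrightarrow> (\<Sum>c\<in>subcube T. (cmod (B i y c))\<^sup>2) \<le> 1"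
    "\<And>x y b. x \<in> X \<Longrightarrow> y \<in> Y \<Longrightarrow> b \<in> subcube (S \<union> T) \<Longrightarrow>
        \<psi> x y b = (\<Sum>i<N. A i x (restr S b) * B i y (restr T b))"
  using assms unfolding factorised_def by blast

lemma factorised_swap:
  assumes "factorised S T X Y N \<psi>"
  shows "factorised T S Y X N (\<lambda>y x. \<psi> x y)"
proof -
  obtain A B where
    "\<And>i x. i < N \<Longrightarrow> x \<in> X \<Longrightarrow> (\<Sum>c\<in>subcube S. (cmod (A i x c))\<^sup>2) \<le> 1"
    "\<And>i y. i < N \<Longrightarrow> y \<in> Y \<Longrightarrow> (\<Sum>c\<in>subcube T. (cmod (B i y c))\<^sup>2) \<le> 1"
    "\<And>x y b. x \<in> X \<Longrightarrow> y \<in> Y \<Longrightarrow> b \<in> subcube (S \<union> T) \<Longrightarrow>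
        \<psi> x y b = (\<Sum>i<N. A i x (restr S b) * B i y (restr T b))"
    using factorisedE[OF assms] by blast
  then show ?thesis
    unfolding factorised_def
    by (intro exI[of _ B] exI[of _ A]) (simp add: Un_commute mult.commute)
qed

lemma isometry_preserves_norm:
  fixes V :: "'a \<Rightarrow> 'a \<Rightarrow> complex"
  assumes "finite C"
    and iso: "\<And>b c. b \<in> C \<Longrightarrow> c \<in> C \<Longrightarrow> (\<Sum>d\<in>C. cnj (V d b) * V d c) = (if b = c then 1 else 0)"
  shows "(\<Sum>d\<in>C. (cmod (\<Sum>c\<in>C. V d c * A c))\<^sup>2) = (\<Sum>c\<in>C. (cmod (A c))\<^sup>2)"
proof -
  have "complex_of_real (\<Sum>d\<in>C. (cmod (\<Sum>c\<in>C. V d c * A c))\<^sup>2)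
      = (\<Sum>d\<in>C. (\<Sum>c\<in>C. V d c * A c) * cnj (\<Sum>b\<in>C. V d b * A b))"
    by (simp only: of_real_sum complex_norm_square)
  also have "\<dots> = (\<Sum>d\<in>C. \<Sum>c\<in>C. \<Sum>b\<in>C. (A c * cnj (A b)) * (cnj (V d b) * V d c))"
    by (simp add: sum_product algebra_simps)
  also have "\<dots> = (\<Sum>c\<in>C. \<Sum>d\<in>C. \<Sum>b\<in>C. (A c * cnj (A b)) * (cnj (V d b) * V d c))"
    by (rule sum.swap)
  also have "\<dots> = (\<Sum>c\<in>C. \<Sum>b\<in>C. \<Sum>d\<in>C. (A c * cnj (A b)) * (cnj (V d b) * V d c))"
    by (rule sum.cong[OF refl], rule sum.swap)
  also have "\<dots> = (\<Sum>c\<in>C. \<Sum>b\<in>C. (A c * cnj (A b)) * (if b = c then 1 else 0))"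
    by (simp only: sum_distrib_left[symmetric] iso cong: sum.cong)
  also have "\<dots> = (\<Sum>c\<in>C. A c * cnj (A c))"
    using assms(1) by (simp add: if_distrib sum.delta cong: if_cong)
  also have "\<dots> = complex_of_real (\<Sum>c\<in>C. (cmod (A c))\<^sup>2)"
    by (simp only: of_real_sum complex_norm_square)
  finally show ?thesis by (simp only: of_real_eq_iff)
qed

lemma local_unitary_isometry:
  assumes U: "unitary_op m U" and S: "S \<subseteq> {..<m}"
    and V: "\<And>b c. b \<in> basis m \<Longrightarrow> c \<in> basis m \<Longrightarrow>
      U b c = (if (\<forall>i. i \<notin> S \<longrightarrow> b i = c i) then V (restr S b) (restr S c) else 0)"
    and bc: "b \<in> subcube S" "c \<in> subcube S"
  shows "(\<Sum>d\<in>subcube S. cnj (V d b) * V d c) = (if b = c then 1 else 0)"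
proof -
  have sub: "subcube S \<subseteq> basis m"
    using S by (auto simp: subcube_def basis_def)
  have r: "restr S d = d" if "d \<in> subcube S" for d
    using that by (auto simp: restr_def subcube_def fun_eq_iff)
  have "(\<Sum>d\<in>basis m. cnj (U d b) * U d c) = (\<Sum>d\<in>subcube S. cnj (U d b) * U d c)"
  proof (rule sum.mono_neutral_right[OF finite_basis sub], rule ballI)
    fix d assume d: "d \<in> basis m - subcube S"
    then obtain i where "i \<notin> S" "d i" by (auto simp: subcube_def)
    moreover have "\<not> c i" using bc \<open>i \<notin> S\<close> by (auto simp: subcube_def)
    moreover have "c \<in> basis m" using bc sub by blast
    ultimately have "U d c = 0" using V[of d c] d by auto
    then show "cnj (U d b) * U d c = 0" by simp
  qed
  also have "\<dots> = (\<Sum>d\<in>subcube S. cnj (V d b) * V d c)"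
  proof (rule sum.cong[OF refl])
    fix d assume d: "d \<in> subcube S"
    have "\<forall>i. i \<notin> S \<longrightarrow> d i = b i" "\<forall>i. i \<notin> S \<longrightarrow> d i = c i"
      using d bc by (auto simp: subcube_def)
    moreover have "d \<in> basis m" "b \<in> basis m" "c \<in> basis m"
      using d bc sub by auto
    ultimately show "cnj (U d b) * U d c = cnj (V d b) * V d c"
      using V[of d b] V[of d c] r d bc by simp
  qed
  finally show ?thesis
    using U bc sub unfolding unitary_op_def by (metis subsetD)
qed

lemma sum_double:
  fixes f :: "nat \<Rightarrow> 'a::comm_monoid_add"
  shows "(\<Sum>i<2 * N. f i) = (\<Sum>i<N. f (2 * i) + f (2 * i + 1))"
  by (induction N) (simp_all add: algebra_simps)

lemma fun_upd_cancel: "c(q := v) = d(q := v) \<Longrightarrow> c q = d q \<Longrightarrow> c = d"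
  by (metis fun_upd_triv fun_upd_upd)

lemma factorised_round:
  assumes fac: "factorised S T X Y N \<psi>"
    and ST: "S \<union> T = {..<m}" "S \<inter> T = {}" and q: "q \<in> S"
    and U: "unitary_op m U" "local_op m S U"
  shows "factorised (S - {q}) (insert q T) X Y (2 * N)
           (\<lambda>x y b. \<Sum>c\<in>basis m. U b c * \<psi> x y c)"
proof -
  obtain A B where
    A: "\<And>i x. i < N \<Longrightarrow> x \<in> X \<Longrightarrow> (\<Sum>c\<in>subcube S. (cmod (A i x c))\<^sup>2) \<le> 1" and
    B: "\<And>i y. i < N \<Longrightarrow> y \<in> Y \<Longrightarrow> (\<Sum>c\<in>subcube T. (cmod (B i y c))\<^sup>2) \<le> 1" and
    \<psi>: "\<And>x y b. x \<in> X \<Longrightarrow> y \<in> Y \<Longrightarrow> b \<in> subcube (S \<union> T) \<Longrightarrow>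
        \<psi> x y b = (\<Sum>i<N. A i x (restr S b) * B i y (restr T b))"
    using factorisedE[OF fac] by blast
  obtain V where V: "\<And>b c. b \<in> basis m \<Longrightarrow> c \<in> basis m \<Longrightarrow>
      U b c = (if (\<forall>i. i \<notin> S \<longrightarrow> b i = c i) then V (restr S b) (restr S c) else 0)"
    using U(2) unfolding local_op_def by blast
  have Sm: "S \<subseteq> {..<m}" "T \<subseteq> {..<m}" using ST by auto
  then have fin: "finite (subcube S)" "finite (subcube T)"
    by (auto intro!: finite_subcube finite_subset[OF _ finite_lessThan])
  define A' where "A' i x d = (\<Sum>c\<in>subcube S. V d c * A i x c)" for i x d
  have iso: "(\<Sum>d\<in>subcube S. cnj (V d b) * V d c) = (if b = c then 1 else 0)"
    if "b \<in> subcube S" "c \<in> subcube S" for b c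
    using U(1) Sm(1) _ that by (rule local_unitary_isometry) (rule V)
  have A': "(\<Sum>c\<in>subcube S. (cmod (A' i x c))\<^sup>2) \<le> 1" if "i < N" "x \<in> X" for i x
  proof -
    have "(\<Sum>c\<in>subcube S. (cmod (A' i x c))\<^sup>2) = (\<Sum>c\<in>subcube S. (cmod (A i x c))\<^sup>2)"
      unfolding A'_def using fin(1) iso by (rule isometry_preserves_norm)
    then show ?thesis using A[OF that] by simp
  qed
  define A2 where "A2 j x c = A' (j div 2) x (c(q := odd j))" for j x c
  define B2 where "B2 j y c = (if c q = odd j then B (j div 2) y (c(q := False)) else 0)" for j y c
  have qT: "q \<notin> T" using q ST by auto
  have "(\<Sum>c\<in>subcube (S - {q}). (cmod (A2 j x c))\<^sup>2) \<le> 1" if "j < 2 * N" "x \<in> X" for j x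
  proof -
    have inj: "inj_on (\<lambda>c. c(q := odd j)) (subcube (S - {q}))"
    proof (rule inj_onI)
      fix c d assume "c \<in> subcube (S - {q})" "d \<in> subcube (S - {q})" "c(q := odd j) = d(q := odd j)"
      moreover from this have "\<not> c q" "\<not> d q" by (auto simp: subcube_def)
      ultimately show "c = d" by (simp add: fun_upd_cancel)
    qed
    have "(\<Sum>c\<in>subcube (S - {q}). (cmod (A2 j x c))\<^sup>2)
        = (\<Sum>c\<in>(\<lambda>c. c(q := odd j)) ` subcube (S - {q}). (cmod (A' (j div 2) x c))\<^sup>2)"
      by (simp add: sum.reindex[OF inj] A2_def o_def)
    also have "\<dots> \<le> (\<Sum>c\<in>subcube S. (cmod (A' (j div 2) x c))\<^sup>2)"
      by (rule sum_mono2[OF fin(1)]) (use q in \<open>auto simp: subcube_def split: if_splits\<close>)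
    also have "\<dots> \<le> 1" using A' that by auto
    finally show ?thesis .
  qed
  moreover have "(\<Sum>c\<in>subcube (insert q T). (cmod (B2 j y c))\<^sup>2) \<le> 1" if "j < 2 * N" "y \<in> Y" for j y
  proof -
    let ?D = "{c \<in> subcube (insert q T). c q = odd j}"
    have finq: "finite (subcube (insert q T))"
      by (rule finite_subcube) (use Sm(2) finite_subset[of T "{..<m}"] in simp)
    have inj: "inj_on (\<lambda>c. c(q := False)) ?D"
    proof (rule inj_onI)
      fix c d assume "c \<in> ?D" "d \<in> ?D" "c(q := False) = d(q := False)"
      moreover from this have "c q = d q" by simp
      ultimately show "c = d" by (simp add: fun_upd_cancel)
    qed
    have "(\<Sum>c\<in>subcube (insert q T). (cmod (B2 j y c))\<^sup>2) = (\<Sum>c\<in>?D. (cmod (B2 j y c))\<^sup>2)"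
      by (rule sum.mono_neutral_right[OF finq]) (auto simp: B2_def)
    also have "\<dots> = (\<Sum>c\<in>(\<lambda>c. c(q := False)) ` ?D. (cmod (B (j div 2) y c))\<^sup>2)"
      by (simp add: sum.reindex[OF inj] B2_def o_def)
    also have "\<dots> \<le> (\<Sum>c\<in>subcube T. (cmod (B (j div 2) y c))\<^sup>2)"
      by (rule sum_mono2[OF fin(2)]) (auto simp: subcube_def split: if_splits)
    also have "\<dots> \<le> 1" using B that by auto
    finally show ?thesis .
  qed
  moreover have "(\<Sum>c\<in>basis m. U b c * \<psi> x y c)
      = (\<Sum>j<2 * N. A2 j x (restr (S - {q}) b) * B2 j y (restr (insert q T) b))"
    if x: "x \<in> X" and y: "y \<in> Y" and "b \<in> subcube ((S - {q}) \<union> insert q T)" for x y b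
  proof -
    have "(S - {q}) \<union> insert q T = {..<m}" using q ST by auto
    with that have b: "b \<in> basis m" by (simp add: basis_eq_subcube)
    let ?F = "\<lambda>s t. (if t = restr T b then V (restr S b) s * (\<Sum>i<N. A i x s * B i y t) else 0)"
    have agree: "(\<forall>i. i \<notin> S \<longrightarrow> b i = c i) \<longleftrightarrow> restr T c = restr T b" if "c \<in> basis m" for c
    proof -
      have "b i = c i" if "i \<notin> S" "i \<notin> T" for i
      proof -
        have "i \<notin> {..<m}" using that ST(1) by blast
        then show ?thesis using b \<open>c \<in> basis m\<close> by (simp add: basis_def)
      qed
      moreover have "i \<notin> S" if "i \<in> T" for i using ST(2) that by auto
      moreover have "restr T c = restr T b \<longleftrightarrow> (\<forall>i\<in>T. b i = c i)"
        by (auto simp: restr_def fun_eq_iff)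
      ultimately show ?thesis by blast
    qed
    have "(\<Sum>c\<in>basis m. U b c * \<psi> x y c) = (\<Sum>c\<in>basis m. ?F (restr S c) (restr T c))"
    proof (rule sum.cong[OF refl])
      fix c assume c: "c \<in> basis m"
      then have "c \<in> subcube (S \<union> T)" by (simp add: ST basis_eq_subcube)
      then show "U b c * \<psi> x y c = ?F (restr S c) (restr T c)"
        using V[OF b c] agree[OF c] \<psi>[OF x y] by simp
    qed
    also have "\<dots> = (\<Sum>s\<in>subcube S. \<Sum>t\<in>subcube T. ?F s t)"
      by (rule sum_basis_split[OF ST])
    also have "\<dots> = (\<Sum>s\<in>subcube S. V (restr S b) s * (\<Sum>i<N. A i x s * B i y (restr T b)))"
      using fin(2) restr_in_subcube[of T b] by (simp add: sum.delta')
    also have "\<dots> = (\<Sum>s\<in>subcube S. \<Sum>i<N. V (restr S b) s * A i x s * B i y (restr T b))"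
      by (simp add: sum_distrib_left mult.assoc)
    also have "\<dots> = (\<Sum>i<N. \<Sum>s\<in>subcube S. V (restr S b) s * A i x s * B i y (restr T b))"
      by (rule sum.swap)
    also have "\<dots> = (\<Sum>i<N. A' i x (restr S b) * B i y (restr T b))"
      by (simp add: A'_def sum_distrib_right)
    also have "\<dots> = (\<Sum>j<2 * N. A2 j x (restr (S - {q}) b) * B2 j y (restr (insert q T) b))"
    proof -
      have "(restr (S - {q}) b)(q := b q) = restr S b"
        using q by (auto simp: restr_def fun_eq_iff)
      moreover have "(restr (insert q T) b)(q := False) = restr T b"
        using qT by (auto simp: restr_def fun_eq_iff)
      moreover have "restr (insert q T) b q = b q" by (simp add: restr_def)
      ultimately show ?thesis
        unfolding sum_double A2_def B2_def by (cases "b q") simp_all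
    qed
    finally show ?thesis .
  qed
  ultimately show ?thesis unfolding factorised_def by blast
qed

lemma factorised_qstate:
  assumes P: "valid_prot n P" and k: "k \<le> rounds P"
  shows "factorised {i. i < nq P \<and> owner P k i} {i. i < nq P \<and> \<not> owner P k i}
     (basis n) (basis n) (2 ^ k) (\<lambda>x y. qstate P n x y k)"
  using k
proof (induction k)
  case 0
  let ?S = "{i. i < nq P \<and> owner P 0 i}" and ?T = "{i. i < nq P \<and> \<not> owner P 0 i}"
  let ?z = "\<lambda>i::nat. False"
  let ?A = "\<lambda>(i::nat) x c. if c = restr ?S (init_basis n x ?z) then 1 else (0::complex)"
  let ?B = "\<lambda>(i::nat) y c. if c = restr ?T (init_basis n ?z y) then 1 else (0::complex)"
  have v: "2 * n \<le> nq P" "\<And>i. i < n \<Longrightarrow> owner0 P i" "\<And>i. n \<le> i \<Longrightarrow> i < 2 * n \<Longrightarrow> \<not> owner0 P i"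
    using P by (auto simp: valid_prot_def)
  have delta: "(\<Sum>c\<in>subcube R. (cmod (if c = d then 1 else (0::complex)))\<^sup>2) \<le> 1"
    if "R \<subseteq> {..<nq P}" for R d
  proof -
    have "finite (subcube R)"
      using that by (auto intro!: finite_subcube finite_subset[OF _ finite_lessThan])
    then show ?thesis by (simp add: if_distrib[of cmod] if_distrib[of "\<lambda>x. x\<^sup>2"] sum.delta' cong: if_cong)
  qed
  have "qstate P n x y 0 b = (\<Sum>i<2 ^ 0. ?A i x (restr ?S b) * ?B i y (restr ?T b))"
    if "x \<in> basis n" "y \<in> basis n" "b \<in> subcube (?S \<union> ?T)" for x y b
  proof -
    have S: "restr ?S (init_basis n x ?z) = restr ?S (init_basis n x y)"
      using v by (auto simp: restr_def init_basis_def fun_eq_iff)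
    have T: "restr ?T (init_basis n ?z y) = restr ?T (init_basis n x y)"
      using v by (auto simp: restr_def init_basis_def fun_eq_iff)
    have "b = init_basis n x y" if e: "restr ?S b = restr ?S (init_basis n x y)"
      "restr ?T b = restr ?T (init_basis n x y)"
    proof
      fix i
      show "b i = init_basis n x y i"
      proof (cases "i < nq P")
        case True
        then show ?thesis
          using fun_cong[OF e(1), of i] fun_cong[OF e(2), of i] by (auto simp: restr_def split: if_splits)
      next
        case False
        then show ?thesis
          using \<open>b \<in> subcube (?S \<union> ?T)\<close> v(1) by (auto simp: subcube_def init_basis_def)
      qed
    qed
    then have "b = init_basis n x y \<longleftrightarrow> restr ?S b = restr ?S (init_basis n x y)
      \<and> restr ?T b = restr ?T (init_basis n x y)" by blast
    then show ?thesis unfolding S T by simp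
  qed
  then show ?case
    unfolding factorised_def
    by (intro exI[of _ ?A] exI[of _ ?B] conjI allI impI ballI delta) auto
next
  case (Suc k)
  let ?S = "{i. i < nq P \<and> owner P k i}" and ?T = "{i. i < nq P \<and> \<not> owner P k i}"
  have v: "sent P k < nq P" "owner P k (sent P k) = player P k" "unitary_op (nq P) (gate P k)"
    "local_op (nq P) {i. i < nq P \<and> owner P k i = player P k} (gate P k)"
    using P Suc.prems by (auto simp: valid_prot_def)
  have IH: "factorised ?S ?T (basis n) (basis n) (2 ^ k) (\<lambda>x y. qstate P n x y k)"
    using Suc by simp
  show ?case
  proof (cases "player P k")
    case True
    have "factorised (?S - {sent P k}) (insert (sent P k) ?T) (basis n) (basis n) (2 * 2 ^ k)
           (\<lambda>x y b. \<Sum>c\<in>basis (nq P). gate P k b c * qstate P n x y k c)"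
      by (rule factorised_round[OF IH]) (use v True in auto)
    moreover have "?S - {sent P k} = {i. i < nq P \<and> owner P (Suc k) i}"
      "insert (sent P k) ?T = {i. i < nq P \<and> \<not> owner P (Suc k) i}"
      using v True by auto
    ultimately show ?thesis by simp
  next
    case False
    have "factorised (?T - {sent P k}) (insert (sent P k) ?S) (basis n) (basis n) (2 * 2 ^ k)
           (\<lambda>y x b. \<Sum>c\<in>basis (nq P). gate P k b c * qstate P n x y k c)"
      by (rule factorised_round[OF factorised_swap[OF IH]]) (use v False in auto)
    then have "factorised (insert (sent P k) ?S) (?T - {sent P k}) (basis n) (basis n) (2 * 2 ^ k)
           (\<lambda>x y b. \<Sum>c\<in>basis (nq P). gate P k b c * qstate P n x y k c)"
      by (rule factorised_swap)
    moreover have "insert (sent P k) ?S = {i. i < nq P \<and> owner P (Suc k) i}"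
      "?T - {sent P k} = {i. i < nq P \<and> \<not> owner P (Suc k) i}"
      using v False by auto
    ultimately show ?thesis by simp
  qed
qed

lemma norm_sum_prod_le_1:
  fixes f g :: "'a \<Rightarrow> complex"
  assumes "(\<Sum>s\<in>C. (cmod (f s))\<^sup>2) \<le> 1" "(\<Sum>s\<in>C. (cmod (g s))\<^sup>2) \<le> 1"
  shows "cmod (\<Sum>s\<in>C. of_bool (h s) * (f s * cnj (g s))) \<le> 1"
proof -
  have "cmod (\<Sum>s\<in>C. of_bool (h s) * (f s * cnj (g s)))
      \<le> (\<Sum>s\<in>C. ((cmod (f s))\<^sup>2 + (cmod (g s))\<^sup>2) / 2)"
  proof (rule order_trans[OF norm_sum], rule sum_mono)
    fix s
    have "2 * (cmod (f s) * cmod (g s)) \<le> (cmod (f s))\<^sup>2 + (cmod (g s))\<^sup>2"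
      using sum_squares_bound[of "cmod (f s)" "cmod (g s)"] by simp
    then show "cmod (of_bool (h s) * (f s * cnj (g s))) \<le> ((cmod (f s))\<^sup>2 + (cmod (g s))\<^sup>2) / 2"
      by (auto simp: norm_mult)
  qed
  also have "\<dots> = ((\<Sum>s\<in>C. (cmod (f s))\<^sup>2) + (\<Sum>s\<in>C. (cmod (g s))\<^sup>2)) / 2"
    by (simp add: sum.distrib sum_divide_distrib add_divide_distrib)
  also have "\<dots> \<le> 1" using assms by simp
  finally show ?thesis .
qed

lemma accept_prob_factorised:
  assumes P: "valid_prot n P"
  obtains I :: "(nat \<times> nat) set" and a b :: "nat \<times> nat \<Rightarrow> (nat \<Rightarrow> bool) \<Rightarrow> complex"
  where "finite I" "card I = 4 ^ rounds P"
    and "\<And>p x. p \<in> I \<Longrightarrow> x \<in> basis n \<Longrightarrow> cmod (a p x) \<le> 1"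
    and "\<And>p y. p \<in> I \<Longrightarrow> y \<in> basis n \<Longrightarrow> cmod (b p y) \<le> 1"
    and "\<And>x y. x \<in> basis n \<Longrightarrow> y \<in> basis n \<Longrightarrow>
       complex_of_real (accept_prob n P x y) = (\<Sum>p\<in>I. a p x * b p y)"
proof -
  define r where "r = rounds P"
  define S where "S = {i. i < nq P \<and> owner P r i}"
  define T where "T = {i. i < nq P \<and> \<not> owner P r i}"
  define N :: nat where "N = 2 ^ r"
  have ST: "S \<union> T = {..<nq P}" "S \<inter> T = {}" by (auto simp: S_def T_def)
  obtain A B where
    A: "\<And>i x. i < N \<Longrightarrow> x \<in> basis n \<Longrightarrow> (\<Sum>c\<in>subcube S. (cmod (A i x c))\<^sup>2) \<le> 1" and
    B: "\<And>i y. i < N \<Longrightarrow> y \<in> basis n \<Longrightarrow> (\<Sum>c\<in>subcube T. (cmod (B i y c))\<^sup>2) \<le> 1" and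
    \<psi>: "\<And>x y b. x \<in> basis n \<Longrightarrow> y \<in> basis n \<Longrightarrow> b \<in> subcube (S \<union> T) \<Longrightarrow>
        qstate P n x y r b = (\<Sum>i<N. A i x (restr S b) * B i y (restr T b))"
    using factorisedE[OF factorised_qstate[OF P order.refl,
        folded r_def, folded S_def T_def N_def]] by blast
  define I where "I = {..<N} \<times> {..<N}"
  define g where "g s \<longleftrightarrow> (outq P \<in> S \<longrightarrow> s (outq P))" for s :: "nat \<Rightarrow> bool"
  define h where "h s \<longleftrightarrow> (outq P \<in> T \<longrightarrow> s (outq P))" for s :: "nat \<Rightarrow> bool"
  define a where "a p x = (\<Sum>s\<in>subcube S. of_bool (g s) * (A (fst p) x s * cnj (A (snd p) x s)))" for p x
  define b where "b p y = (\<Sum>s\<in>subcube T. of_bool (h s) * (B (fst p) y s * cnj (B (snd p) y s)))" for p y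
  have "finite I" by (simp add: I_def)
  moreover have "card I = 4 ^ rounds P"
    by (simp add: I_def N_def r_def power_mult_distrib[symmetric])
  moreover have "cmod (a p x) \<le> 1" if "p \<in> I" "x \<in> basis n" for p x
    unfolding a_def by (rule norm_sum_prod_le_1) (use that A in \<open>auto simp: I_def\<close>)
  moreover have "cmod (b p y) \<le> 1" if "p \<in> I" "y \<in> basis n" for p y
    unfolding b_def by (rule norm_sum_prod_le_1) (use that B in \<open>auto simp: I_def\<close>)
  moreover have "complex_of_real (accept_prob n P x y) = (\<Sum>p\<in>I. a p x * b p y)"
    if x: "x \<in> basis n" and y: "y \<in> basis n" for x y
  proof -
    let ?F = "\<lambda>p s t. of_bool (g s) * (A (fst p) x s * cnj (A (snd p) x s)) *
                (of_bool (h t) * (B (fst p) y t * cnj (B (snd p) y t)))"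
    have out: "outq P \<in> S \<or> outq P \<in> T"
      using P by (auto simp: valid_prot_def S_def T_def)
    have "complex_of_real (accept_prob n P x y)
       = (\<Sum>b\<in>basis (nq P). of_bool (b (outq P)) * (qstate P n x y r b * cnj (qstate P n x y r b)))"
      unfolding accept_prob_def r_def[symmetric] of_real_sum
      by (rule sum.mono_neutral_cong_left) (auto simp: finite_basis simp flip: complex_norm_square)
    also have "\<dots> = (\<Sum>b\<in>basis (nq P). \<Sum>p\<in>I. ?F p (restr S b) (restr T b))"
    proof (rule sum.cong[OF refl])
      fix b assume "b \<in> basis (nq P)"
      then have b: "b \<in> subcube (S \<union> T)" by (simp add: ST basis_eq_subcube)
      have o: "of_bool (b (outq P)) = of_bool (g (restr S b)) * (of_bool (h (restr T b)) :: complex)"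
        using out by (auto simp: g_def h_def restr_def)
      have "of_bool (b (outq P)) * (qstate P n x y r b * cnj (qstate P n x y r b))
        = (\<Sum>i<N. \<Sum>j<N. of_bool (b (outq P)) * ((A i x (restr S b) * B i y (restr T b)) *
             cnj (A j x (restr S b) * B j y (restr T b))))"
        unfolding \<psi>[OF x y b] cnj_sum sum_product by (simp only: sum_distrib_left)
      also have "\<dots> = (\<Sum>p\<in>I. ?F p (restr S b) (restr T b))"
        unfolding I_def sum.cartesian_product o by (rule sum.cong) (auto simp: algebra_simps)
      finally show "of_bool (b (outq P)) * (qstate P n x y r b * cnj (qstate P n x y r b))
        = (\<Sum>p\<in>I. ?F p (restr S b) (restr T b))" .
    qed
    also have "\<dots> = (\<Sum>p\<in>I. \<Sum>b\<in>basis (nq P). ?F p (restr S b) (restr T b))"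
      by (rule sum.swap)
    also have "\<dots> = (\<Sum>p\<in>I. \<Sum>s\<in>subcube S. \<Sum>t\<in>subcube T. ?F p s t)"
      by (rule sum.cong[OF refl], rule sum_basis_split[OF ST])
    also have "\<dots> = (\<Sum>p\<in>I. a p x * b p y)"
      unfolding a_def b_def sum_product ..
    finally show ?thesis .
  qed
  ultimately show ?thesis using that by blast
qed

subsection \<open>Discrepancy of the inner product function\<close>

definition overlap :: "(nat \<Rightarrow> bool) \<Rightarrow> (nat \<Rightarrow> bool) \<Rightarrow> nat" where
  "overlap x y = card {i. x i \<and> y i}"

definition ip_sign :: "(nat \<Rightarrow> bool) \<Rightarrow> (nat \<Rightarrow> bool) \<Rightarrow> real" where
  "ip_sign x y = (-1) ^ overlap x y"

lemma abs_ip_sign [simp]: "\<bar>ip_sign x y\<bar> = 1"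
  by (simp add: ip_sign_def power_abs)

lemma ip_sign_square [simp]: "ip_sign x y * ip_sign x y = 1"
  by (simp add: ip_sign_def flip: power_add)

lemma finite_overlap: "x \<in> basis m \<Longrightarrow> finite {i. x i \<and> y i}"
  by (rule finite_subset[of _ "{..<m}"]) (auto simp: basis_def not_le[symmetric])

lemma overlap_le: "x \<in> basis m \<Longrightarrow> overlap x y \<le> m"
  unfolding overlap_def using card_mono[of "{..<m}" "{i. x i \<and> y i}"]
  by (fastforce simp: basis_def not_le[symmetric])

lemma ip_sign_flip:
  assumes x: "x \<in> basis m"
  shows "ip_sign (x(i := \<not> x i)) y = (if y i then - ip_sign x y else ip_sign x y)"
proof (cases "y i")
  case False
  then have "{j. (x(i := \<not> x i)) j \<and> y j} = {j. x j \<and> y j}" by auto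
  then show ?thesis using False by (simp add: ip_sign_def overlap_def)
next
  case True
  define R where "R = {j. x j \<and> y j} - {i}"
  have R: "finite R" "i \<notin> R" using finite_overlap[OF x] by (auto simp: R_def)
  show ?thesis
  proof (cases "x i")
    case xi: True
    have "{j. x j \<and> y j} = insert i R" "{j. (x(i := \<not> x i)) j \<and> y j} = R"
      using True xi by (auto simp: R_def)
    then show ?thesis using True R by (simp add: ip_sign_def overlap_def)
  next
    case xi: False
    have "{j. x j \<and> y j} = R" "{j. (x(i := \<not> x i)) j \<and> y j} = insert i R"
      using True xi by (auto simp: R_def)
    then show ?thesis using True R by (simp add: ip_sign_def overlap_def)
  qed
qed

lemma ip_sign_orthogonal:
  assumes y: "y \<in> basis m" "z \<in> basis m"
  shows "(\<Sum>x\<in>basis m. ip_sign x y * ip_sign x z) = (if y = z then 2 ^ m else 0)"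
proof (cases "y = z")
  case True
  then show ?thesis by (simp add: card_basis)
next
  case False
  then obtain i where i: "y i \<noteq> z i" by blast
  then have im: "i < m" using y by (auto simp: basis_def not_le[symmetric])
  have "(\<Sum>x\<in>basis m. ip_sign x y * ip_sign x z)
      = (\<Sum>x\<in>basis m. ip_sign (x(i := \<not> x i)) y * ip_sign (x(i := \<not> x i)) z)"
    by (rule sum.reindex_bij_witness[where i = "\<lambda>x. x(i := \<not> x i)" and j = "\<lambda>x. x(i := \<not> x i)"])
      (use im in \<open>auto simp: basis_def\<close>)
  also have "\<dots> = (\<Sum>x\<in>basis m. - (ip_sign x y * ip_sign x z))"
    by (rule sum.cong[OF refl]) (use i in \<open>auto simp: ip_sign_flip\<close>)
  finally show ?thesis using False by (simp add: sum_negf)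
qed

lemma lindsey:
  assumes Y: "Y \<subseteq> basis m"
    and a: "\<And>x. x \<in> basis m \<Longrightarrow> cmod (a x) \<le> 1" and b: "\<And>y. y \<in> Y \<Longrightarrow> cmod (b y) \<le> 1"
  shows "cmod (\<Sum>x\<in>basis m. \<Sum>y\<in>Y. of_real (ip_sign x y) * (a x * b y)) \<le> 2 ^ m * sqrt (card Y)"
proof -
  have finY: "finite Y" using Y finite_basis finite_subset by blast
  define w where "w x = (\<Sum>y\<in>Y. of_real (ip_sign x y) * b y)" for x
  have "complex_of_real (\<Sum>x\<in>basis m. (cmod (w x))\<^sup>2) = (\<Sum>x\<in>basis m. w x * cnj (w x))"
    by (simp only: of_real_sum complex_norm_square)
  also have "\<dots> = (\<Sum>x\<in>basis m. \<Sum>y\<in>Y. \<Sum>z\<in>Y. (b y * cnj (b z)) * of_real (ip_sign x y * ip_sign x z))"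
    unfolding w_def cnj_sum sum_product by (simp add: algebra_simps)
  also have "\<dots> = (\<Sum>y\<in>Y. \<Sum>x\<in>basis m. \<Sum>z\<in>Y. (b y * cnj (b z)) * of_real (ip_sign x y * ip_sign x z))"
    by (rule sum.swap)
  also have "\<dots> = (\<Sum>y\<in>Y. \<Sum>z\<in>Y. \<Sum>x\<in>basis m. (b y * cnj (b z)) * of_real (ip_sign x y * ip_sign x z))"
    by (rule sum.cong[OF refl], rule sum.swap)
  also have "\<dots> = (\<Sum>y\<in>Y. \<Sum>z\<in>Y. (b y * cnj (b z)) * of_real (if y = z then 2 ^ m else 0))"
    using Y by (intro sum.cong refl) (simp only: sum_distrib_left[symmetric] of_real_sum[symmetric] ip_sign_orthogonal subset_iff)
  also have "\<dots> = (\<Sum>y\<in>Y. of_real (2 ^ m) * (b y * cnj (b y)))"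
    using finY by (simp add: if_distrib sum.delta mult.commute cong: if_cong)
  also have "\<dots> = complex_of_real (2 ^ m * (\<Sum>y\<in>Y. (cmod (b y))\<^sup>2))"
    by (simp only: of_real_sum of_real_mult complex_norm_square sum_distrib_left)
  finally have "(\<Sum>x\<in>basis m. (cmod (w x))\<^sup>2) = 2 ^ m * (\<Sum>y\<in>Y. (cmod (b y))\<^sup>2)"
    by (simp only: of_real_eq_iff)
  also have "\<dots> \<le> 2 ^ m * (\<Sum>y\<in>Y. 1)"
    by (intro mult_left_mono sum_mono) (auto simp: b power_le_one)
  finally have w2: "(\<Sum>x\<in>basis m. (cmod (w x))\<^sup>2) \<le> 2 ^ m * card Y" by simp
  have "cmod (\<Sum>x\<in>basis m. \<Sum>y\<in>Y. of_real (ip_sign x y) * (a x * b y)) = cmod (\<Sum>x\<in>basis m. a x * w x)"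
    by (simp add: w_def sum_distrib_left algebra_simps)
  also have "\<dots> \<le> (\<Sum>x\<in>basis m. cmod (w x))"
    by (rule order_trans[OF norm_sum], rule sum_mono) (simp add: norm_mult a mult_left_le_one_le)
  also have "\<dots> \<le> sqrt ((\<Sum>x\<in>basis m. (cmod (w x))\<^sup>2) * card (basis m))"
    by (rule real_le_rsqrt) (rule sum_squared_le_sum_of_squares)
  also have "\<dots> \<le> sqrt ((2 ^ m)\<^sup>2 * card Y)"
    by (rule real_sqrt_le_mono) (use w2 in \<open>simp add: card_basis power2_eq_square\<close>)
  also have "\<dots> = 2 ^ m * sqrt (card Y)"
    by (simp add: real_sqrt_mult)
  finally show ?thesis .
qed

text \<open>Multiplying out one factor of the entrywise power only changes the bounded weights,
  so no decomposition of the whole power is needed.\<close>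

lemma lindsey_power:
  fixes F :: "(nat \<Rightarrow> bool) \<Rightarrow> (nat \<Rightarrow> bool) \<Rightarrow> complex"
  assumes Y: "Y \<subseteq> basis m"
    and F: "\<And>x y. x \<in> basis m \<Longrightarrow> y \<in> Y \<Longrightarrow> F x y = (\<Sum>p\<in>I. \<alpha> p x * \<beta> p y)"
    and \<alpha>: "\<And>p x. p \<in> I \<Longrightarrow> x \<in> basis m \<Longrightarrow> cmod (\<alpha> p x) \<le> 1"
    and \<beta>: "\<And>p y. p \<in> I \<Longrightarrow> y \<in> Y \<Longrightarrow> cmod (\<beta> p y) \<le> 1"
    and "\<And>x. x \<in> basis m \<Longrightarrow> cmod (a x) \<le> 1" and "\<And>y. y \<in> Y \<Longrightarrow> cmod (b y) \<le> 1"
  shows "cmod (\<Sum>x\<in>basis m. \<Sum>y\<in>Y. of_real (ip_sign x y) * (a x * b y) * F x y ^ d)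
     \<le> real (card I) ^ d * (2 ^ m * sqrt (card Y))"
  using assms(5,6)
proof (induction d arbitrary: a b)
  case 0
  then show ?case using lindsey[OF Y] by simp
next
  case (Suc d)
  let ?G = "\<lambda>p x y. of_real (ip_sign x y) * ((a x * \<alpha> p x) * (b y * \<beta> p y)) * F x y ^ d"
  have "(\<Sum>x\<in>basis m. \<Sum>y\<in>Y. of_real (ip_sign x y) * (a x * b y) * F x y ^ Suc d)
      = (\<Sum>x\<in>basis m. \<Sum>y\<in>Y. \<Sum>p\<in>I. ?G p x y)"
  proof (intro sum.cong refl)
    fix x y assume xy: "x \<in> basis m" "y \<in> Y"
    have "of_real (ip_sign x y) * (a x * b y) * F x y ^ Suc d
        = (of_real (ip_sign x y) * (a x * b y) * F x y ^ d) * F x y" by simp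
    also have "\<dots> = (\<Sum>p\<in>I. (of_real (ip_sign x y) * (a x * b y) * F x y ^ d) * (\<alpha> p x * \<beta> p y))"
      by (subst (2) F[OF xy]) (rule sum_distrib_left)
    also have "\<dots> = (\<Sum>p\<in>I. ?G p x y)"
      by (rule sum.cong[OF refl]) (simp add: mult_ac)
    finally show "of_real (ip_sign x y) * (a x * b y) * F x y ^ Suc d = (\<Sum>p\<in>I. ?G p x y)" .
  qed
  also have "\<dots> = (\<Sum>x\<in>basis m. \<Sum>p\<in>I. \<Sum>y\<in>Y. ?G p x y)"
    by (rule sum.cong[OF refl], rule sum.swap)
  also have "\<dots> = (\<Sum>p\<in>I. \<Sum>x\<in>basis m. \<Sum>y\<in>Y. ?G p x y)"
    by (rule sum.swap)
  finally have eq: "(\<Sum>x\<in>basis m. \<Sum>y\<in>Y. of_real (ip_sign x y) * (a x * b y) * F x y ^ Suc d)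
      = (\<Sum>p\<in>I. \<Sum>x\<in>basis m. \<Sum>y\<in>Y. ?G p x y)" .
  have "cmod (\<Sum>x\<in>basis m. \<Sum>y\<in>Y. ?G p x y) \<le> real (card I) ^ d * (2 ^ m * sqrt (card Y))"
    if "p \<in> I" for p
    by (rule Suc.IH) (use that \<alpha> \<beta> Suc.prems in \<open>auto simp: norm_mult intro!: mult_le_one\<close>)
  then have "(\<Sum>p\<in>I. cmod (\<Sum>x\<in>basis m. \<Sum>y\<in>Y. ?G p x y))
      \<le> real (card I) * (real (card I) ^ d * (2 ^ m * sqrt (card Y)))"
    by (rule sum_bounded_above)
  then show ?case unfolding eq by (simp add: mult_ac order_trans[OF norm_sum])
qed

subsection \<open>Lower bounds for protocols\<close>

definition pad :: "nat \<Rightarrow> nat \<Rightarrow> (nat \<Rightarrow> bool) \<Rightarrow> (nat \<Rightarrow> bool)" where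
  "pad m s x = (\<lambda>i. if i < m then x i else i < m + s)"

lemma pad_in_basis: "m + s \<le> n \<Longrightarrow> pad m s x \<in> basis n"
  by (auto simp: pad_def basis_def)

lemma COUNT_pad:
  assumes "x \<in> basis m" "m + s \<le> n"
  shows "COUNT n t (pad m s x) (pad m s y) \<longleftrightarrow> overlap x y + s = t"
proof -
  have *: "x i \<Longrightarrow> i < m" for i using assms(1) by (auto simp: basis_def not_le[symmetric])
  have "{i. i < n \<and> pad m s x i \<and> pad m s y i} = {i. x i \<and> y i} \<union> {m..<m + s}"
    using assms(2) * by (fastforce simp: pad_def)
  moreover have "card ({i. x i \<and> y i} \<union> {m..<m + s}) = overlap x y + s"
    unfolding overlap_def
    by (subst card_Un_disjoint) (use finite_overlap[OF assms(1)] * in \<open>fastforce+\<close>)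
  ultimately show ?thesis by (simp add: COUNT_def)
qed

lemma protocol_discrepancy:
  assumes P: "valid_prot n P" and ms: "m + s \<le> n" and Y: "Y \<subseteq> basis m"
  shows "\<bar>\<Sum>x\<in>basis m. \<Sum>y\<in>Y. ip_sign x y * accept_prob n P (pad m s x) (pad m s y) ^ d\<bar>
     \<le> (4 ^ rounds P) ^ d * (2 ^ m * sqrt (card Y))"
proof -
  obtain I :: "(nat \<times> nat) set" and a b :: "nat \<times> nat \<Rightarrow> (nat \<Rightarrow> bool) \<Rightarrow> complex"
    where "finite I" and I: "card I = 4 ^ rounds P"
    and a: "\<And>p x. p \<in> I \<Longrightarrow> x \<in> basis n \<Longrightarrow> cmod (a p x) \<le> 1"
    and b: "\<And>p y. p \<in> I \<Longrightarrow> y \<in> basis n \<Longrightarrow> cmod (b p y) \<le> 1"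
    and ab: "\<And>x y. x \<in> basis n \<Longrightarrow> y \<in> basis n \<Longrightarrow>
       complex_of_real (accept_prob n P x y) = (\<Sum>p\<in>I. a p x * b p y)"
    using accept_prob_factorised[OF P] by blast
  let ?s = "\<Sum>x\<in>basis m. \<Sum>y\<in>Y. ip_sign x y * accept_prob n P (pad m s x) (pad m s y) ^ d"
  have "\<bar>?s\<bar> = cmod (complex_of_real ?s)" by (simp only: norm_of_real)
  also have "complex_of_real ?s = (\<Sum>x\<in>basis m. \<Sum>y\<in>Y. of_real (ip_sign x y) * (1 * 1) *
       complex_of_real (accept_prob n P (pad m s x) (pad m s y)) ^ d)" by simp
  also have "cmod \<dots> \<le> real (card I) ^ d * (2 ^ m * sqrt (card Y))"
    by (rule lindsey_power[OF Y, where \<alpha> = "\<lambda>p x. a p (pad m s x)" and \<beta> = "\<lambda>p x. b p (pad m s x)"])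
      (auto simp: a b ab pad_in_basis[OF ms])
  finally show ?thesis by (simp add: I)
qed

lemma accept_prob_nonneg: "0 \<le> accept_prob n P x y"
  by (simp add: accept_prob_def sum_nonneg)

text \<open>With Alice's input arbitrary and Bob's a singleton, COUNT becomes the index function.\<close>

lemma sqrt_le_rounds:
  assumes P: "computes n (COUNT n t) P" and t: "t \<le> n"
  shows "sqrt (real (n - t)) \<le> 6 * 4 ^ rounds P"
proof (cases "n - t = 0")
  case False
  define m where "m = n - t"
  define s where "s = t - 1"
  define e :: "nat \<Rightarrow> nat \<Rightarrow> bool" where "e j = (\<lambda>i. i = j)" for j
  define Y where "Y = e ` {..<m}"
  define p where "p x y = accept_prob n P (pad m s x) (pad m s y)" for x y
  define \<sigma> :: real where "\<sigma> = (if t = 0 then 1 else -1)"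
  have ms: "m + s \<le> n" using t by (auto simp: m_def s_def)
  have Yb: "Y \<subseteq> basis m" by (auto simp: Y_def e_def basis_def)
  have inj: "inj_on e {..<m}" by (auto simp: inj_on_def e_def fun_eq_iff)
  have cY: "card Y = m" by (simp add: Y_def card_image[OF inj])
  have v: "valid_prot n P" using P by (simp add: computes_def)
  have gap: "1 / 6 \<le> \<sigma> * (ip_sign x y * (p x y - 1 / 2))" if x: "x \<in> basis m" and "y \<in> Y" for x y
  proof -
    obtain j where y: "y = e j" using \<open>y \<in> Y\<close> by (auto simp: Y_def)
    have "{i. x i \<and> y i} = (if x j then {j} else {})" by (auto simp: y e_def)
    then have ov: "overlap x y = (if x j then 1 else 0)" by (simp add: overlap_def)
    have pb: "COUNT n t (pad m s x) (pad m s y) \<Longrightarrow> 2 / 3 \<le> p x y"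
      "\<not> COUNT n t (pad m s x) (pad m s y) \<Longrightarrow> p x y \<le> 1 / 3"
      using P pad_in_basis[OF ms] by (auto simp: computes_def p_def)
    have "t - Suc 0 \<noteq> t" if "t \<noteq> 0" using that by simp
    then show ?thesis
      using pb unfolding COUNT_pad[OF x ms] ip_sign_def ov
      by (cases "t = 0"; cases "x j") (auto simp: \<sigma>_def s_def)
  qed
  have zero: "(\<Sum>x\<in>basis m. ip_sign x y) = 0" if "y \<in> Y" for y
  proof -
    have "y \<noteq> (\<lambda>i. False)" using that by (auto simp: Y_def e_def fun_eq_iff)
    moreover have "(\<lambda>i. False) \<in> basis m" by (simp add: basis_def)
    moreover have "ip_sign x (\<lambda>i. False) = 1" for x by (simp add: ip_sign_def overlap_def)
    ultimately show ?thesis using ip_sign_orthogonal[of y m "\<lambda>i. False"] that Yb by auto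
  qed
  have "2 ^ m * real m / 6 = (\<Sum>x\<in>basis m. \<Sum>y\<in>Y. 1 / 6)"
    by (simp add: cY card_basis)
  also have "\<dots> \<le> (\<Sum>x\<in>basis m. \<Sum>y\<in>Y. \<sigma> * (ip_sign x y * (p x y - 1 / 2)))"
    by (intro sum_mono gap)
  also have "\<dots> = \<sigma> * (\<Sum>x\<in>basis m. \<Sum>y\<in>Y. ip_sign x y * (p x y - 1 / 2))"
    by (simp only: sum_distrib_left)
  also have "(\<Sum>x\<in>basis m. \<Sum>y\<in>Y. ip_sign x y * (p x y - 1 / 2))
      = (\<Sum>x\<in>basis m. \<Sum>y\<in>Y. ip_sign x y * p x y ^ 1) - (\<Sum>x\<in>basis m. \<Sum>y\<in>Y. ip_sign x y) / 2"
    by (simp add: sum_subtractf sum_divide_distrib right_diff_distrib)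
  also have "(\<Sum>x\<in>basis m. \<Sum>y\<in>Y. ip_sign x y) = 0"
    by (subst sum.swap) (simp add: zero)
  also have "\<sigma> * ((\<Sum>x\<in>basis m. \<Sum>y\<in>Y. ip_sign x y * p x y ^ 1) - 0 / 2)
      \<le> \<bar>\<Sum>x\<in>basis m. \<Sum>y\<in>Y. ip_sign x y * p x y ^ 1\<bar>"
    by (auto simp: \<sigma>_def)
  also have "\<dots> \<le> (4 ^ rounds P) ^ 1 * (2 ^ m * sqrt (card Y))"
    unfolding p_def by (rule protocol_discrepancy[OF v ms Yb])
  finally have "2 ^ m * real m \<le> 2 ^ m * (6 * 4 ^ rounds P * sqrt m)"
    by (simp add: cY)
  then have "sqrt m * sqrt m \<le> 6 * 4 ^ rounds P * sqrt m" by simp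
  moreover have "sqrt m > 0" using False by (simp add: m_def)
  ultimately show ?thesis unfolding m_def by (simp only: mult_le_cancel_right_pos)
qed simp

lemma exists_popular_overlap:
  obtains k where "k \<le> m"
    "4 ^ m \<le> real (m + 1) * card {p \<in> basis m \<times> basis m. overlap (fst p) (snd p) = k}"
proof -
  let ?K = "\<lambda>k. {p \<in> basis m \<times> basis m. overlap (fst p) (snd p) = k}"
  have "\<exists>k\<in>{..m}. 4 ^ m \<le> (m + 1) * card (?K k)"
  proof (rule ccontr)
    assume "\<not> ?thesis"
    then have lt: "(m + 1) * card (?K k) < 4 ^ m" if "k \<le> m" for k using that by (simp add: not_le)
    have "basis m \<times> basis m = (\<Union>k\<in>{..m}. ?K k)"
      using overlap_le by auto
    then have "card (basis m \<times> basis m) = card (\<Union>k\<in>{..m}. ?K k)" by (rule arg_cong)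
    also have "\<dots> = (\<Sum>k\<le>m. card (?K k))"
      by (rule card_UN_disjoint) (auto simp: finite_basis)
    finally have "card (basis m \<times> basis m) = (\<Sum>k\<le>m. card (?K k))" .
    moreover have "card (basis m \<times> basis m) = 4 ^ m"
      by (simp add: card_cartesian_product card_basis flip: power_mult_distrib)
    ultimately have "(m + 1) * 4 ^ m = (\<Sum>k\<le>m. (m + 1) * card (?K k))"
      by (simp add: sum_distrib_left)
    also have "\<dots> < (\<Sum>k\<le>m. 4 ^ m)" by (rule sum_strict_mono) (use lt in auto)
    finally show False by simp
  qed
  then obtain k where k: "k \<le> m" "4 ^ m \<le> (m + 1) * card (?K k)" by auto
  have "4 ^ m \<le> real (m + 1) * card (?K k)"
  proof -
    have "real (4 ^ m) \<le> real ((m + 1) * card (?K k))" using k(2) by (simp only: of_nat_le_iff)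
    then show ?thesis by (simp add: algebra_simps)
  qed
  with k(1) show ?thesis by (rule that)
qed

text \<open>Entrywise powers of the acceptance matrix replace error reduction by repetition: the ratio
  between accepting and rejecting entries grows to \<open>2^d\<close>, which beats the loss \<open>t + 1\<close> from
  restricting to a single value of the overlap.\<close>

lemma sqrt_power_le_rounds:
  assumes P: "computes n (COUNT n t) P" and t: "2 * t \<le> n" and d: "2 * (t + 1) \<le> 2 ^ d"
  shows "sqrt (2 ^ t) \<le> (4 ^ (rounds P + 1)) ^ d"
proof -
  obtain k where k: "k \<le> t"
    and K: "4 ^ t \<le> real (t + 1) * card {p \<in> basis t \<times> basis t. overlap (fst p) (snd p) = k}"
    by (rule exists_popular_overlap)
  define s where "s = t - k"
  define p where "p x y = accept_prob n P (pad t s x) (pad t s y)" for x y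
  define Q where "Q = basis t \<times> basis t"
  define L where "L = {p \<in> basis t \<times> basis t. overlap (fst p) (snd p) = k}"
  have LQ: "L \<subseteq> Q" by (auto simp: L_def Q_def)
  have finQ: "finite Q" by (simp add: Q_def finite_basis)
  have ts: "t + s \<le> n" using t by (simp add: s_def)
  have v: "valid_prot n P" using P by (simp add: computes_def)
  have count: "COUNT n t (pad t s (fst q)) (pad t s (snd q)) \<longleftrightarrow> q \<in> L" if "q \<in> Q" for q
    using COUNT_pad[of "fst q" t s n t "snd q"] ts that k by (auto simp: s_def Q_def L_def)
  have hi: "2 / 3 \<le> p (fst q) (snd q)" if "q \<in> L" for q
    using P pad_in_basis[OF ts] count[of q] that LQ by (auto simp: computes_def p_def)
  have lo: "p (fst q) (snd q) \<le> 1 / 3" if "q \<in> Q - L" for q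
    using P pad_in_basis[OF ts] count[of q] that by (auto simp: computes_def p_def)
  have p0: "0 \<le> p x y" for x y by (simp add: p_def accept_prob_nonneg)
  let ?f = "\<lambda>q. ip_sign (fst q) (snd q) * p (fst q) (snd q) ^ d"
  have cQ: "real (card Q) = 4 ^ t"
    by (simp add: Q_def card_cartesian_product card_basis flip: power_mult_distrib)
  have "4 ^ t * 2 \<le> real (t + 1) * card L * 2"
    using K by (simp add: L_def)
  also have "\<dots> \<le> 2 ^ d * real (card L)"
  proof -
    have "real (2 * (t + 1)) \<le> 2 ^ d"
      using of_nat_mono[OF d, where ?'a = real] by simp
    then have "real (2 * (t + 1)) * real (card L) \<le> 2 ^ d * real (card L)"
      by (rule mult_right_mono) simp
    then show ?thesis by (simp add: algebra_simps)
  qed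
  finally have cL: "4 ^ t * 2 \<le> 2 ^ d * real (card L)" .
  have "4 ^ t * (1 / 3) ^ d = (4 ^ t * 2) * (1 / 3) ^ d - 4 ^ t * (1 / 3 :: real) ^ d"
    by simp
  also have "\<dots> \<le> (2 ^ d * real (card L)) * (1 / 3) ^ d - 4 ^ t * (1 / 3) ^ d"
    by (intro diff_right_mono mult_right_mono cL) simp
  also have "\<dots> = card L * (2 / 3) ^ d - card Q * (1 / 3) ^ d"
    by (simp add: cQ power_divide)
  also have "\<dots> \<le> (\<Sum>q\<in>L. p (fst q) (snd q) ^ d) - (\<Sum>q\<in>Q - L. p (fst q) (snd q) ^ d)"
  proof (rule diff_mono)
    show "card L * (2 / 3) ^ d \<le> (\<Sum>q\<in>L. p (fst q) (snd q) ^ d)"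
      by (rule sum_bounded_below) (auto intro!: power_mono hi)
    have "(\<Sum>q\<in>Q - L. p (fst q) (snd q) ^ d) \<le> card (Q - L) * (1 / 3) ^ d"
      by (rule sum_bounded_above) (auto intro!: power_mono lo p0)
    also have "\<dots> \<le> card Q * (1 / 3) ^ d"
      by (intro mult_right_mono) (auto intro!: card_mono finQ)
    finally show "(\<Sum>q\<in>Q - L. p (fst q) (snd q) ^ d) \<le> card Q * (1 / 3) ^ d" .
  qed
  also have "(\<Sum>q\<in>L. p (fst q) (snd q) ^ d) = \<bar>\<Sum>q\<in>L. ?f q\<bar>"
  proof -
    have "(\<Sum>q\<in>L. ?f q) = (\<Sum>q\<in>L. (-1) ^ k * p (fst q) (snd q) ^ d)"
      by (rule sum.cong) (auto simp: L_def ip_sign_def)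
    also have "\<dots> = (-1) ^ k * (\<Sum>q\<in>L. p (fst q) (snd q) ^ d)"
      by (rule sum_distrib_left[symmetric])
    finally show ?thesis by (simp add: abs_mult power_abs sum_nonneg p0)
  qed
  also have "\<bar>\<Sum>q\<in>L. ?f q\<bar> - (\<Sum>q\<in>Q - L. p (fst q) (snd q) ^ d) \<le> \<bar>\<Sum>q\<in>Q. ?f q\<bar>"
  proof -
    have "(\<Sum>q\<in>Q. ?f q) = (\<Sum>q\<in>Q - L. ?f q) + (\<Sum>q\<in>L. ?f q)"
      by (rule sum.subset_diff[OF LQ finQ])
    moreover have "\<bar>\<Sum>q\<in>Q - L. ?f q\<bar> \<le> (\<Sum>q\<in>Q - L. p (fst q) (snd q) ^ d)"
      by (rule order_trans[OF sum_abs]) (simp add: abs_mult p0)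
    ultimately show ?thesis by linarith
  qed
  also have "(\<Sum>q\<in>Q. ?f q) = (\<Sum>x\<in>basis t. \<Sum>y\<in>basis t. ip_sign x y * p x y ^ d)"
    unfolding Q_def by (simp add: sum.cartesian_product split_def)
  also have "\<bar>\<dots>\<bar> \<le> (4 ^ rounds P) ^ d * (2 ^ t * sqrt (card (basis t)))"
    unfolding p_def by (rule protocol_discrepancy[OF v ts order.refl])
  finally have "4 ^ t * (1 / 3) ^ d \<le> (4 ^ rounds P) ^ d * (2 ^ t * sqrt (2 ^ t))"
    by (simp add: card_basis)
  moreover have "(4::real) ^ t = (2 ^ t * sqrt (2 ^ t)) * sqrt (2 ^ t)"
  proof -
    have "(4::real) ^ t = 2 ^ t * 2 ^ t" by (simp flip: power_mult_distrib)
    also have "(2::real) ^ t * 2 ^ t = (2 ^ t * sqrt (2 ^ t)) * sqrt (2 ^ t)"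
      by (simp only: mult.assoc real_sqrt_mult_self) simp
    finally show ?thesis .
  qed
  ultimately have "(2 ^ t * sqrt (2 ^ t)) * (sqrt (2 ^ t) * (1 / 3) ^ d)
      \<le> (2 ^ t * sqrt (2 ^ t)) * (4 ^ rounds P) ^ d"
    by (simp only: mult_ac)
  then have "sqrt (2 ^ t) * (1 / 3) ^ d \<le> (4 ^ rounds P) ^ d"
    by (subst (asm) mult_le_cancel_left_pos) auto
  then have "sqrt (2 ^ t) \<le> (4 ^ rounds P) ^ d * 3 ^ d"
    by (simp add: field_simps)
  also have "\<dots> \<le> (4 ^ rounds P) ^ d * 4 ^ d"
    by (intro mult_left_mono power_mono) auto
  finally show ?thesis by (simp add: power_add power_mult_distrib mult.commute)
qed

subsection \<open>Every function has a protocol\<close>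

text \<open>\<open>BQC\<close> is a \<open>LEAST\<close>, so it only means something once some protocol is known to
  compute the function. Alice sends her whole input, and in one more round Bob xors the value
  into the work qubit \<open>2 * n\<close>.\<close>

definition trivial_prot :: "nat \<Rightarrow> ((nat \<Rightarrow> bool) \<Rightarrow> (nat \<Rightarrow> bool) \<Rightarrow> bool) \<Rightarrow> qprot" where
  "trivial_prot n f = \<lparr>nq = 2 * n + 1, rounds = n + 1, owner0 = (\<lambda>i. i < n), player = (\<lambda>k. k < n),
     sent = (\<lambda>k. if k < n then k else 2 * n),
     gate = (\<lambda>k b c. if k < n then of_bool (b = c)
        else of_bool (b = c(2 * n := (c (2 * n) \<noteq> f (\<lambda>i. i < n \<and> c i) (\<lambda>i. i < n \<and> c (i + n)))))),
     outq = 2 * n\<rparr>"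

lemma owner_trivial_prot:
  "k \<le> n \<Longrightarrow> owner (trivial_prot n f) k i \<longleftrightarrow> k \<le> i \<and> i < n"
  by (induction k) (auto simp: trivial_prot_def fun_upd_def)

lemma unitary_op_permutation:
  assumes \<pi>: "\<And>c. c \<in> basis m \<Longrightarrow> \<pi> c \<in> basis m" and inj: "inj_on \<pi> (basis m)"
  shows "unitary_op m (\<lambda>b c. of_bool (b = \<pi> c))"
  unfolding unitary_op_def
proof (intro ballI)
  fix b c assume bc: "b \<in> basis m" "c \<in> basis m"
  have "(\<Sum>d\<in>basis m. cnj (of_bool (d = \<pi> b)) * of_bool (d = \<pi> c))
      = (\<Sum>d\<in>basis m. if d = \<pi> b then of_bool (\<pi> b = \<pi> c) else (0::complex))"
    by (rule sum.cong) auto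
  also have "\<dots> = of_bool (\<pi> b = \<pi> c)" using \<pi>[OF bc(1)] by (simp add: finite_basis)
  also have "\<dots> = (if b = c then 1 else 0)" using inj bc by (auto dest: inj_onD)
  finally show "(\<Sum>d\<in>basis m. cnj (of_bool (d = \<pi> b)) * of_bool (d = \<pi> c))
      = (if b = c then 1 else (0::complex))" .
qed

lemma local_op_identity: "local_op m S (\<lambda>b c. of_bool (b = c))"
  unfolding local_op_def
proof (intro exI ballI)
  fix b c :: "nat \<Rightarrow> bool"
  have "b = c \<longleftrightarrow> (\<forall>i. i \<notin> S \<longrightarrow> b i = c i) \<and> restr S b = restr S c"
    unfolding restr_def fun_eq_iff by auto
  then show "of_bool (b = c) = (if \<forall>i. i \<notin> S \<longrightarrow> b i = c i
      then of_bool (restr S b = restr S c) else (0::complex))" by simp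
qed

lemma local_op_everywhere: "local_op m {i. i < m} U"
  unfolding local_op_def
proof (intro exI ballI)
  fix b c assume bc: "b \<in> basis m" "c \<in> basis m"
  have "restr {i. i < m} b = b" "restr {i. i < m} c = c" "\<forall>i. i \<notin> {i. i < m} \<longrightarrow> b i = c i"
    using bc by (auto simp: basis_def restr_def fun_eq_iff)
  then show "U b c = (if \<forall>i. i \<notin> {i. i < m} \<longrightarrow> b i = c i
      then U (restr {i. i < m} b) (restr {i. i < m} c) else 0)" by simp
qed

lemma computes_trivial_prot: "computes n f (trivial_prot n f)"
proof -
  let ?P = "trivial_prot n f" and ?m = "2 * n + 1"
  define \<pi> where "\<pi> c = c(2 * n := (c (2 * n) \<noteq> f (\<lambda>i. i < n \<and> c i) (\<lambda>i. i < n \<and> c (i + n))))"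
    for c :: "nat \<Rightarrow> bool"
  have \<pi>2: "\<pi> (\<pi> c) = c" for c
  proof -
    have eqs: "(\<lambda>i. i < n \<and> \<pi> c i) = (\<lambda>i. i < n \<and> c i)"
      "(\<lambda>i. i < n \<and> \<pi> c (i + n)) = (\<lambda>i. i < n \<and> c (i + n))"
      by (auto simp: \<pi>_def)
    show ?thesis unfolding \<pi>_def[of "\<pi> c"] eqs by (auto simp: \<pi>_def fun_eq_iff)
  qed
  have \<pi>b: "\<pi> c \<in> basis ?m" if "c \<in> basis ?m" for c
    using that by (auto simp: basis_def \<pi>_def)
  have inj: "inj_on \<pi> (basis ?m)" by (rule inj_on_inverseI) (rule \<pi>2)
  have gate1: "gate ?P k = (\<lambda>b c. of_bool (b = c))" if "k < n" for k
    using that by (simp add: trivial_prot_def fun_eq_iff)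
  have gate2: "gate ?P n = (\<lambda>b c. of_bool (b = \<pi> c))"
    by (simp add: trivial_prot_def \<pi>_def fun_eq_iff)
  have sel: "nq ?P = ?m" "rounds ?P = n + 1" "outq ?P = 2 * n" "owner0 ?P = (\<lambda>i. i < n)"
    "player ?P = (\<lambda>k. k < n)" "sent ?P = (\<lambda>k. if k < n then k else 2 * n)"
    by (simp_all add: trivial_prot_def)
  have step: "sent ?P k < nq ?P \<and> owner ?P k (sent ?P k) = player ?P k \<and> unitary_op (nq ?P) (gate ?P k)
      \<and> local_op (nq ?P) {i. i < nq ?P \<and> owner ?P k i = player ?P k} (gate ?P k)" if "k < n + 1" for k
  proof (cases "k < n")
    case True
    moreover have "unitary_op ?m (\<lambda>b c. of_bool (b = c))"
      using unitary_op_permutation[of ?m "\<lambda>c. c"] by simp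
    ultimately show ?thesis
      by (simp add: sel owner_trivial_prot gate1 local_op_identity)
  next
    case False
    then have k: "k = n" using that by simp
    have "{i. i < nq ?P \<and> owner ?P n i = player ?P n} = {i. i < ?m}"
      by (auto simp: sel owner_trivial_prot)
    then show ?thesis
      unfolding k gate2 using unitary_op_permutation[OF \<pi>b inj] local_op_everywhere
      by (simp add: sel owner_trivial_prot)
  qed
  have "valid_prot n ?P"
    unfolding valid_prot_def using step by (simp add: sel)
  moreover have "accept_prob n ?P x y = of_bool (f x y)" if x: "x \<in> basis n" and y: "y \<in> basis n" for x y
  proof -
    let ?i = "init_basis n x y"
    have ib: "?i \<in> basis ?m" by (simp add: basis_def init_basis_def)
    have st: "qstate ?P n x y k b = of_bool (b = ?i)" if "k \<le> n" "b \<in> basis ?m" for k b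
      using that
    proof (induction k arbitrary: b)
      case (Suc k)
      have "qstate ?P n x y (Suc k) b = (\<Sum>c\<in>basis ?m. if c = b then of_bool (b = ?i) else 0)"
        unfolding qstate.simps sel using Suc by (intro sum.cong) (auto simp: gate1)
      then show ?case using Suc.prems by (simp add: finite_basis)
    qed simp
    have fin: "qstate ?P n x y (Suc n) b = of_bool (b = \<pi> ?i)" for b
    proof -
      have "qstate ?P n x y (Suc n) b = (\<Sum>c\<in>basis ?m. if c = ?i then of_bool (b = \<pi> ?i) else 0)"
        unfolding qstate.simps sel by (intro sum.cong) (auto simp: gate2 st)
      then show ?thesis using ib by (simp add: finite_basis)
    qed
    have "x i \<Longrightarrow> i < n" "y i \<Longrightarrow> i < n" for i
      using x y by (auto simp: basis_def not_le[symmetric])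
    then have "(\<lambda>i. i < n \<and> ?i i) = x" "(\<lambda>i. i < n \<and> ?i (i + n)) = y" "\<not> ?i (2 * n)"
      by (auto simp: init_basis_def fun_eq_iff)
    then have out: "\<pi> ?i (2 * n) = f x y" by (simp add: \<pi>_def)
    have "accept_prob n ?P x y = (\<Sum>b\<in>{b \<in> basis ?m. b (2 * n)}. if b = \<pi> ?i then 1 else 0)"
      unfolding accept_prob_def sel by (intro sum.cong) (auto simp: fin simp del: qstate.simps)
    also have "\<dots> = of_bool (f x y)"
      using \<pi>b[OF ib] out by (simp add: finite_basis)
    finally show ?thesis .
  qed
  ultimately show ?thesis by (auto simp: computes_def)
qed

lemma BQC_attained:
  obtains P where "computes n f P" "rounds P = BQC n f"
proof -
  have "\<exists>r P. computes n f P \<and> rounds P = r" using computes_trivial_prot by blast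
  then have "\<exists>P. computes n f P \<and> rounds P = BQC n f" unfolding BQC_def by (rule LeastI_ex)
  then show ?thesis using that by blast
qed

lemma log_le_BQC:
  assumes "2 * t \<le> n" "n > 0"
  shows "log 2 n \<le> 4 * real (BQC n (COUNT n t)) + 7"
proof -
  obtain P where P: "computes n (COUNT n t) P" and r: "rounds P = BQC n (COUNT n t)"
    by (rule BQC_attained)
  let ?r = "rounds P"
  have "sqrt (n - t) \<le> 6 * 4 ^ ?r" using sqrt_le_rounds[OF P] assms by simp
  then have "(sqrt (n - t))\<^sup>2 \<le> (6 * 4 ^ ?r)\<^sup>2" by (rule power_mono) simp
  then have "real (n - t) \<le> 36 * 16 ^ ?r"
    by (simp add: power2_eq_square mult_ac flip: power_mult_distrib)
  then have "real n \<le> 72 * 16 ^ ?r" using assms by simp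
  also have "\<dots> \<le> 2 powr (4 * real ?r + 7)"
  proof -
    have "(2::real) powr (4 * real ?r + 7) = 2 powr real (4 * ?r + 7)" by simp
    also have "\<dots> = 2 ^ (4 * ?r + 7)" by (rule powr_realpow) simp
    also have "\<dots> = 128 * 16 ^ ?r" by (simp add: power_add power_mult)
    finally show ?thesis by simp
  qed
  finally have "log 2 n \<le> log 2 (2 powr (4 * real ?r + 7))" 
    using assms(2) by (subst log_le_cancel_iff) auto
  then show ?thesis by (simp add: r)
qed

lemma div_log_le_BQC:
  assumes "2 * t \<le> n"
  shows "real t / log 2 t \<le> 16 * (real (BQC n (COUNT n t)) + 1)"
proof (cases "t < 2")
  case True
  then have "t = 0 \<or> t = 1" by auto
  then show ?thesis by auto
next
  case False
  obtain P where P: "computes n (COUNT n t) P" and r: "rounds P = BQC n (COUNT n t)"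
    by (rule BQC_attained)
  let ?r = "rounds P" and ?l = "log 2 (real t)"
  define d where "d = nat \<lceil>log 2 (2 * (t + 1))\<rceil>"
  have l1: "?l \<ge> 1" using False by (simp add: le_log_iff)
  have "log 2 (2 * (t + 1)) \<le> d" unfolding d_def by linarith
  then have "2 * (real t + 1) \<le> 2 powr d"
    by (subst (asm) log_le_iff) auto
  then have "real (2 * (t + 1)) \<le> real (2 ^ d)" by (simp add: powr_realpow)
  then have d2: "2 * (t + 1) \<le> 2 ^ d" by (simp only: of_nat_le_iff)
  have "2 * (real t + 1) \<le> real t ^ 3"
  proof -
    have "2 * (real t + 1) \<le> 4 * real t" using False by simp
    also have "\<dots> \<le> (real t * real t) * real t"
      using False mult_mono[of 2 "real t" 2 "real t"] by (intro mult_right_mono) auto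
    finally show ?thesis by (simp add: power3_eq_cube)
  qed
  then have "log 2 (2 * (t + 1)) \<le> log 2 (real t ^ 3)" by (subst log_le_cancel_iff) (use False in auto)
  then have "log 2 (2 * (t + 1)) \<le> 3 * ?l" using False by (simp add: log_nat_power)
  moreover have "d \<le> log 2 (2 * (t + 1)) + 1"
  proof -
    have "0 \<le> log 2 (2 * (t + 1))" by simp
    then show ?thesis unfolding d_def by linarith
  qed
  ultimately have dl: "d \<le> 4 * ?l" using l1 by linarith
  have "sqrt (2 ^ t) \<le> (4 ^ (?r + 1)) ^ d" by (rule sqrt_power_le_rounds[OF P assms d2])
  then have "(sqrt (2 ^ t))\<^sup>2 \<le> ((4 ^ (?r + 1)) ^ d)\<^sup>2" by (rule power_mono) simp
  then have "(2::real) ^ t \<le> ((4 ^ (?r + 1)) ^ d)\<^sup>2" by simp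
  also have "\<dots> = 2 ^ (4 * (?r + 1) * d)"
  proof -
    have "((4 ^ (?r + 1)) ^ d)\<^sup>2 = ((2 ^ 2) ^ ((?r + 1) * d * 2) :: real)"
      by (simp only: power_mult) simp
    also have "\<dots> = 2 ^ (2 * ((?r + 1) * d * 2))" by (simp only: power_mult)
    also have "2 * ((?r + 1) * d * 2) = 4 * (?r + 1) * d" by (simp add: algebra_simps)
    finally show ?thesis .
  qed
  finally have "t \<le> 4 * (?r + 1) * d" by (subst (asm) power_increasing_iff) auto
  then have "real t \<le> real (4 * (?r + 1) * d)" by (simp only: of_nat_le_iff)
  also have "\<dots> = 4 * (real ?r + 1) * d" by simp
  also have "\<dots> \<le> 4 * (real ?r + 1) * (4 * ?l)" by (rule mult_left_mono[OF dl]) simp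
  finally show ?thesis using l1 by (simp add: r divide_le_eq algebra_simps)
qed

theorem theorem7p2:
  fixes t :: "nat \<Rightarrow> nat"
  assumes "mono t"
    and "\<And>n. real (t n) \<le> real n / 2"
  shows "(\<lambda>n. real (BQC n (COUNT n (t n))))
           \<in> \<Omega>(\<lambda>n. real (t n) / log 2 (real (t n)) + log 2 (real n))"
proof (rule landau_omega.bigI)
  show "(1 / 43 :: real) > 0" by simp
  show "\<forall>\<^sub>F n in at_top. 1 / 43 * norm (real (t n) / log 2 (real (t n)) + log 2 (real n))
      \<le> norm (real (BQC n (COUNT n (t n))))"
    using eventually_ge_at_top[of "2 ^ 8"]
  proof eventually_elim
    case (elim n)
    let ?r = "real (BQC n (COUNT n (t n)))"
    have t: "2 * t n \<le> n" using assms(2)[of n] by linarith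
    have n: "n > 0" using elim by simp
    have ln: "log 2 n \<le> 4 * ?r + 7" by (rule log_le_BQC[OF t n])
    have "8 = log 2 (2 ^ 8)" by (subst log_nat_power) auto
    also have "\<dots> \<le> log 2 n" using elim n by (subst log_le_cancel_iff) auto
    finally have l8: "8 \<le> log 2 n" .
    have r: "?r \<ge> 1"
      using ln l8 by (cases "BQC n (COUNT n (t n))") auto
    define u where "u = real (t n) / log 2 (t n)"
    have u: "u \<le> 16 * (?r + 1)" unfolding u_def by (rule div_log_le_BQC[OF t])
    have "0 \<le> u" unfolding u_def by (cases "t n = 0") auto
    then have "\<bar>u + log 2 n\<bar> = u + log 2 n" using l8 by (intro abs_of_nonneg) simp
    also have "\<dots> \<le> 16 * (?r + 1) + (4 * ?r + 7)" using u ln by (rule add_mono)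
    also have "\<dots> \<le> 43 * ?r" using r by (simp del: of_nat_add)
    finally have "\<bar>u + log 2 n\<bar> \<le> 43 * ?r" .
    then show ?case unfolding u_def by simp
  qed
qed

end
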